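(* Let $G=(V,E)$ be a finite simple undirected graph with nonempty vertex set. Then the stable set polytope $\mathrm{Stab}(G)$ is indecomposable if and only if $G$ is connected. Likewise, the clique polytope $\mathrm{Cli}(G)$ is indecomposable if and only if the complement graph $\overline{G}$ is connected.
   Context: A set $S\subseteq V$ is stable if no edge $ab\in E$ has $a,b\in S$; it is a clique if $ab\in E$ for all distinct $a,b\in S$ (the empty set is both). $\overline{G}=(V,\overline{E})$ with $\overline{E}=\{ab: a,b\in V, a\ne b, ab\notin E\}$. For $S\subseteq V$, $1_S\in\{0,1\}^V$ is its characteristic vector. $\mathrm{Stab}(G)=\mathrm{conv}\{1_S: S\subseteq V\text{ stable}\}\subset\mathbb{R}^V$ and $\mathrm{Cli}(G)=\mathrm{Stab}(\overline{G})$. The Minkowski sum is $Q+R=\{q+r: q\in Q, r\in R\}$. Two polytopes are homothetic if one is obtained from the other by a translation and a dilation with positive factor. A polytope $P$ is decomposable if there are polytopes $Q,R$ with $P=Q+R$ such that neither $Q$ nor $R$ is homothetic to $P$; otherwise $P$ is indecomposable. *)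

theory Defs
  imports "HOL-Analysis.Analysis" "HOL-Library.Set_Algebras"
begin

text \<open>The vertex set is the finite (hence nonempty) type \<open>'v\<close>, so that \<open>real ^ 'v\<close> is the
  ambient space. A graph is given by its edge set \<open>E\<close>, the edge \<open>ab\<close> being the
  two-element set \<open>{a, b}\<close>.\<close>

definition simple_graph :: "'v::finite set set \<Rightarrow> bool" where
  "simple_graph E \<longleftrightarrow> (\<forall>e\<in>E. card e = 2)"

definition complement_graph :: "'v::finite set set \<Rightarrow> 'v set set" where
  "complement_graph E = {{a, b} | a b. a \<noteq> b \<and> {a, b} \<notin> E}"

definition graph_connected :: "'v::finite set set \<Rightarrow> bool" where
  "graph_connected E \<longleftrightarrow> (\<forall>u v. (u, v) \<in> {(a, b). {a, b} \<in> E}\<^sup>*)"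

definition stable_set :: "'v::finite set set \<Rightarrow> 'v set \<Rightarrow> bool" where
  "stable_set E S \<longleftrightarrow> \<not> (\<exists>a\<in>S. \<exists>b\<in>S. {a, b} \<in> E)"

definition char_vec :: "'v::finite set \<Rightarrow> real ^ 'v" where
  "char_vec S = (\<chi> v. if v \<in> S then 1 else 0)"

definition Stab :: "'v::finite set set \<Rightarrow> (real ^ 'v) set" where
  "Stab E = convex hull {char_vec S | S. stable_set E S}"

definition Cli :: "'v::finite set set \<Rightarrow> (real ^ 'v) set" where
  "Cli E = Stab (complement_graph E)"

definition homothetic :: "'a::real_vector set \<Rightarrow> 'a set \<Rightarrow> bool" where
  "homothetic P Q \<longleftrightarrow> (\<exists>c>0. \<exists>t. Q = (\<lambda>x. t + c *\<^sub>R x) ` P)"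

text \<open>\<open>Q + R\<close> is the elementwise (Minkowski) sum of sets from \<open>Set_Algebras\<close>.
  As usual, a summand may be a single point.\<close>

definition decomposable :: "'a::euclidean_space set \<Rightarrow> bool" where
  "decomposable P \<longleftrightarrow> polytope P \<and>
    (\<exists>Q R. polytope Q \<and> polytope R \<and> P = Q + R \<and> \<not> homothetic Q P \<and> \<not> homothetic R P)"

definition indecomposable :: "'a::euclidean_space set \<Rightarrow> bool" where
  "indecomposable P \<longleftrightarrow> polytope P \<and> \<not> decomposable P"

end

theory Submission
  imports Defs
begin

text \<open>
  The clique polytope is the stable set polytope of the complement, so only \<open>Stab\<close> matters.

  If \<open>G\<close> is disconnected, the vertices split into nonempty sides \<open>A\<close> and \<open>- A\<close> with no edge in
  between. A stable set is then the same as a pair of independently chosen stable sets, one in each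
  side, so \<open>Stab\<close> is the Minkowski sum of the two corresponding polytopes. Each of them is flat in
  the coordinates of the other side, while \<open>Stab\<close> is flat in no coordinate; hence neither is
  homothetic to \<open>Stab\<close>.

  If \<open>G\<close> is connected and \<open>Stab = Q + R\<close>, write every \<open>char_vec S\<close> as \<open>q S + r S\<close> with \<open>q S\<close> in
  \<open>Q\<close> and \<open>r S\<close> in \<open>R\<close>. The argument rests on one fact about sums (\<open>summand_const_on_face\<close>): a
  linear functional that attains its minimum over \<open>Q + R\<close> at two points takes equal values on
  their \<open>Q\<close>-parts. The functionals \<open>x $ w\<close> and \<open>- x $ w\<close> are minimal at the stable sets that avoid,
  respectively contain, \<open>w\<close>; hence \<open>q S $ w\<close> depends only on whether \<open>w \<in> S\<close>. Let \<open>d w\<close> be the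
  difference of the two values. For an edge \<open>uv\<close> the functional \<open>- x $ u - x $ v\<close> is minimal at
  both \<open>{u}\<close> and \<open>{v}\<close>, because no stable set contains both ends, and this forces \<open>d u = d v\<close>.
  By connectedness \<open>d\<close> is a constant \<open>c\<close>, so \<open>q S = q {} + c * char_vec S\<close> for all stable \<open>S\<close>.
  Such a dilation on the vertices extends to the polytopes (\<open>summand_eq_dilation\<close>): \<open>Q\<close> is a
  translate of \<open>c Stab\<close> and \<open>R\<close> one of \<open>(1 - c) Stab\<close>. One of the two factors is positive.
\<close>

section \<open>Minkowski summands of a polytope\<close>

text \<open>Otherwise exchanging the \<open>R\<close>-parts of the two points would give a point of \<open>Q + R\<close> with a
  smaller value.\<close>

lemma summand_const_on_face:
  fixes f :: "'a::real_vector \<Rightarrow> real"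
  assumes f: "linear f"
    and mem: "a \<in> Q" "b \<in> R" "a' \<in> Q" "b' \<in> R"
    and min: "\<And>y. y \<in> Q + R \<Longrightarrow> m \<le> f y"
    and "f (a + b) = m" "f (a' + b') = m"
  shows "f a = f a'"
proof -
  have "m \<le> f (a + b')" "m \<le> f (a' + b)"
    using min mem by (auto intro: set_plus_intro)
  then show ?thesis
    using assms(7,8) by (simp add: linear_add[OF f])
qed

text \<open>The minimum of a linear functional over the hull of \<open>V\<close> is attained at some \<open>v\<close> in \<open>V\<close>, and
  then the minimum over \<open>Q\<close> is attained at \<open>q v\<close>. So no hyperplane separates a point of \<open>Q\<close> from
  the hull of the points \<open>q v\<close>.\<close>

lemma summand_eq_hull_of_parts:
  fixes V Q R :: "'a::euclidean_space set"
  assumes "finite V" "V \<noteq> {}"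
    and sum: "convex hull V = Q + R" and "convex Q"
    and q: "\<And>v. v \<in> V \<Longrightarrow> q v \<in> Q" and r: "\<And>v. v \<in> V \<Longrightarrow> v - q v \<in> R"
  shows "Q = convex hull (q ` V)"
proof
  show "convex hull (q ` V) \<subseteq> Q"
    using \<open>convex Q\<close> q by (intro hull_minimal) auto
  show "Q \<subseteq> convex hull (q ` V)"
  proof (rule ccontr)
    assume "\<not> Q \<subseteq> convex hull (q ` V)"
    then obtain z where z: "z \<in> Q" "z \<notin> convex hull (q ` V)" by blast
    have "closed (convex hull (q ` V))"
      using \<open>finite V\<close> by (simp add: compact_imp_closed finite_imp_compact_convex_hull)
    then obtain a b where ab: "a \<bullet> z < b" "\<And>x. x \<in> convex hull (q ` V) \<Longrightarrow> b < a \<bullet> x"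
      using separating_hyperplane_closed_point[OF convex_convex_hull] z(2) by blast
    have "\<exists>v\<in>V. \<forall>x\<in>V. a \<bullet> v \<le> a \<bullet> x"
      using assms(1,2) by (intro continuous_attains_inf finite_imp_compact continuous_intros)
    then obtain v where v: "v \<in> V" "\<And>x. x \<in> V \<Longrightarrow> a \<bullet> v \<le> a \<bullet> x" by blast
    have "convex hull V \<subseteq> {y. a \<bullet> v \<le> a \<bullet> y}"
      using v(2) by (intro hull_minimal) (auto simp: convex_halfspace_ge)
    moreover have "z + (v - q v) \<in> convex hull V"
      using sum z(1) r[OF v(1)] by (simp add: set_plus_intro)
    ultimately have "a \<bullet> q v \<le> a \<bullet> z"
      by (auto simp: inner_add_right inner_diff_right)
    moreover have "b < a \<bullet> q v"
      using ab(2) v(1) by (simp add: hull_inc)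
    ultimately show False using ab(1) by simp
  qed
qed

lemma summand_eq_dilation:
  fixes V Q R :: "'a::euclidean_space set"
  assumes "finite V" "V \<noteq> {}" "convex hull V = Q + R" "convex Q"
    and "\<And>v. v \<in> V \<Longrightarrow> t + c *\<^sub>R v \<in> Q" "\<And>v. v \<in> V \<Longrightarrow> v - (t + c *\<^sub>R v) \<in> R"
  shows "Q = (\<lambda>x. t + c *\<^sub>R x) ` (convex hull V)"
  using summand_eq_hull_of_parts[of V Q R "\<lambda>v. t + c *\<^sub>R v"] assms
  by (simp add: convex_hull_affinity)

lemma homothetic_sym:
  assumes "homothetic P Q"
  shows "homothetic Q P"
proof -
  obtain c t where "c > 0" and Q: "Q = (\<lambda>x. t + c *\<^sub>R x) ` P"
    using assms unfolding homothetic_def by blast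
  have "P = (\<lambda>y. - ((1 / c) *\<^sub>R t) + (1 / c) *\<^sub>R y) ` Q"
    using \<open>c > 0\<close> unfolding Q image_image by (simp add: scaleR_add_right)
  then show ?thesis
    using \<open>c > 0\<close> unfolding homothetic_def
    by (intro exI[of _ "1 / c"] conjI exI[of _ "- ((1 / c) *\<^sub>R t)"]) simp_all
qed

lemma homothetic_if_dilation:
  assumes "Q = (\<lambda>x. t + c *\<^sub>R x) ` P" "c > 0"
  shows "homothetic Q P"
  by (rule homothetic_sym) (use assms in \<open>auto simp: homothetic_def\<close>)

text \<open>The complementary part of \<open>v\<close> is \<open>- t + (1 - c) v\<close>, so both summands are dilations of the sum,
  with factors \<open>c\<close> and \<open>1 - c\<close>. These cannot both fail to be positive.\<close>

lemma homothetic_summand: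
  fixes V Q R :: "'a::euclidean_space set"
  assumes "finite V" "V \<noteq> {}" and sum: "convex hull V = Q + R" and "convex Q" "convex R"
    and q: "\<And>v. v \<in> V \<Longrightarrow> t + c *\<^sub>R v \<in> Q" and r: "\<And>v. v \<in> V \<Longrightarrow> v - (t + c *\<^sub>R v) \<in> R"
  shows "homothetic Q (convex hull V) \<or> homothetic R (convex hull V)"
proof (cases "c > 0")
  case True
  have "Q = (\<lambda>x. t + c *\<^sub>R x) ` (convex hull V)"
    using assms by (intro summand_eq_dilation)
  then show ?thesis
    using True homothetic_if_dilation by blast
next
  case False
  have eq: "- t + (1 - c) *\<^sub>R v = v - (t + c *\<^sub>R v)" for v
    by (simp add: algebra_simps)
  have "R = (\<lambda>x. - t + (1 - c) *\<^sub>R x) ` (convex hull V)"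
  proof (rule summand_eq_dilation)
    show "convex hull V = R + Q" using sum by (simp add: add.commute)
    show "- t + (1 - c) *\<^sub>R v \<in> R" if "v \<in> V" for v
      unfolding eq using r that .
    show "v - (- t + (1 - c) *\<^sub>R v) \<in> Q" if "v \<in> V" for v
      unfolding eq using q[OF that] by (simp add: add.commute)
  qed (use assms in simp_all)
  moreover have "1 - c > 0" using False by simp
  ultimately show ?thesis
    using homothetic_if_dilation by blast
qed

section \<open>Stable set polytopes\<close>

lemma char_vec_nth [simp]: "char_vec S $ v = (if v \<in> S then 1 else 0)"
  by (simp add: char_vec_def)

lemma stable_set_empty [simp]: "stable_set E {}"
  by (simp add: stable_set_def)

lemma stable_set_singleton: "simple_graph E \<Longrightarrow> stable_set E {v}"
  by (force simp: stable_set_def simple_graph_def)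

lemma stable_set_subset: "stable_set E S \<Longrightarrow> T \<subseteq> S \<Longrightarrow> stable_set E T"
  unfolding stable_set_def by blast

lemma simple_graph_complement: "simple_graph (complement_graph E)"
  by (auto simp: simple_graph_def complement_graph_def)

lemma char_vec_in_Stab: "stable_set E S \<Longrightarrow> char_vec S \<in> Stab E"
  unfolding Stab_def by (auto intro: hull_inc)

lemma polytope_Stab: "polytope (Stab E)"
proof -
  have "finite {char_vec S | S. stable_set E S}" by simp
  then show ?thesis unfolding polytope_def Stab_def by blast
qed

lemma linear_le_on_Stab:
  assumes f: "linear f" and "\<And>S. stable_set E S \<Longrightarrow> m \<le> f (char_vec S)" and "x \<in> Stab E"
  shows "m \<le> (f x :: real)"
proof -
  have "convex {y. m \<le> f y}"
    using convex_linear_vimage[OF f convex_real_interval(1)[of m]] by (simp add: vimage_def)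
  then have "Stab E \<subseteq> {y. m \<le> f y}"
    unfolding Stab_def using assms(2) by (intro hull_minimal) auto
  then show ?thesis using assms(3) by blast
qed

section \<open>Disconnected graphs\<close>

definition Stab_within :: "'v::finite set set \<Rightarrow> 'v set \<Rightarrow> (real ^ 'v) set" where
  "Stab_within E A = convex hull {char_vec S | S. stable_set E S \<and> S \<subseteq> A}"

lemma polytope_Stab_within: "polytope (Stab_within E A)"
proof -
  have "finite {char_vec S | S. stable_set E S \<and> S \<subseteq> A}" by simp
  then show ?thesis unfolding polytope_def Stab_within_def by blast
qed

text \<open>Homotheties preserve flatness in the coordinate \<open>v\<close>.\<close>

lemma not_homothetic_Stab_within:
  fixes E :: "'v::finite set set"
  assumes "simple_graph E" "v \<notin> A"
  shows "\<not> homothetic (Stab_within E A) (Stab E)"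
proof
  assume "homothetic (Stab_within E A) (Stab E)"
  then obtain c t where *: "Stab E = (\<lambda>x. t + c *\<^sub>R x) ` Stab_within E A"
    unfolding homothetic_def by blast
  have "convex {x :: real ^ 'v. x $ v = 0}"
    by (auto simp: convex_def)
  then have "Stab_within E A \<subseteq> {x. x $ v = 0}"
    unfolding Stab_within_def using \<open>v \<notin> A\<close> by (intro hull_minimal) auto
  then have flat: "x $ v = t $ v" if "x \<in> Stab E" for x
    using that unfolding * by auto
  show False
    using flat[OF char_vec_in_Stab, of "{}"]
      flat[OF char_vec_in_Stab[OF stable_set_singleton[OF assms(1), of v]]] by simp
qed

lemma Stab_split:
  assumes noedge: "\<And>a b. a \<in> A \<Longrightarrow> b \<notin> A \<Longrightarrow> {a, b} \<notin> E"
  shows "Stab E = Stab_within E A + Stab_within E (- A)"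
proof -
  have "{char_vec S | S. stable_set E S}
      = {char_vec S | S. stable_set E S \<and> S \<subseteq> A} + {char_vec S | S. stable_set E S \<and> S \<subseteq> - A}"
    (is "?L = ?Q + ?R")
  proof (intro equalityI subsetI)
    fix x assume "x \<in> ?L"
    then obtain S where S: "x = char_vec S" "stable_set E S" by blast
    have "x = char_vec (S \<inter> A) + char_vec (S \<inter> - A)"
      by (auto simp: S vec_eq_iff)
    moreover have "stable_set E (S \<inter> A)" "stable_set E (S \<inter> - A)"
      using S(2) by (auto intro: stable_set_subset)
    ultimately show "x \<in> ?Q + ?R"
      by (auto intro!: set_plus_intro)
  next
    fix x assume "x \<in> ?Q + ?R"
    then obtain S T where ST: "stable_set E S" "S \<subseteq> A" "stable_set E T" "T \<subseteq> - A"
      and x: "x = char_vec S + char_vec T"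
      by (auto elim!: set_plus_elim)
    have "x = char_vec (S \<union> T)"
      using ST by (auto simp: x vec_eq_iff)
    moreover have "stable_set E (S \<union> T)"
      unfolding stable_set_def
    proof clarify
      fix a b assume ab: "a \<in> S \<union> T" "b \<in> S \<union> T" "{a, b} \<in> E"
      then have "a \<in> A \<longleftrightarrow> b \<in> A"
        using noedge[of a b] noedge[of b a] by (auto simp: insert_commute)
      then show False
        using ab ST unfolding stable_set_def by blast
    qed
    ultimately show "x \<in> ?L" by blast
  qed
  then show ?thesis
    unfolding Stab_def Stab_within_def by (simp add: convex_hull_set_plus)
qed

lemma decomposable_Stab_if_disconnected:
  assumes "simple_graph E" "\<not> graph_connected E"
  shows "decomposable (Stab E)"
proof -
  obtain u v where uv: "(u, v) \<notin> {(a, b). {a, b} \<in> E}\<^sup>*"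
    using assms(2) unfolding graph_connected_def by blast
  define A where "A = {w. (u, w) \<in> {(a, b). {a, b} \<in> E}\<^sup>*}"
  have "{a, b} \<notin> E" if "a \<in> A" "b \<notin> A" for a b
    using that unfolding A_def by (auto intro: rtrancl_into_rtrancl)
  then have "Stab E = Stab_within E A + Stab_within E (- A)"
    by (rule Stab_split)
  moreover have "v \<notin> A" "u \<notin> - A"
    using uv by (auto simp: A_def)
  ultimately show ?thesis
    using polytope_Stab polytope_Stab_within not_homothetic_Stab_within[OF assms(1)]
    unfolding decomposable_def by metis
qed

section \<open>Connected graphs\<close>

lemma connected_imp_constant:
  assumes "graph_connected E" and edge: "\<And>u v. {u, v} \<in> E \<Longrightarrow> d u = d v"
  shows "d u = d v"
proof -
  have "(u, v) \<in> {(a, b). {a, b} \<in> E}\<^sup>*"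
    using assms(1) unfolding graph_connected_def by blast
  then show ?thesis
    by induction (auto dest: edge)
qed

text \<open>Minimising and maximising single coordinates shows that \<open>q\<close> stretches each coordinate \<open>w\<close> by
  some factor \<open>d w\<close>; the functional \<open>- x $ u - x $ v\<close> of an edge \<open>uv\<close> identifies \<open>d u\<close> and \<open>d v\<close>.\<close>

lemma Stab_summand_dilation:
  fixes E :: "'v::finite set set"
  assumes "simple_graph E" "graph_connected E" and sum: "Stab E = Q + R"
    and q: "\<And>S. stable_set E S \<Longrightarrow> q S \<in> Q"
    and r: "\<And>S. stable_set E S \<Longrightarrow> char_vec S - q S \<in> R"
  shows "\<exists>c. \<forall>S. stable_set E S \<longrightarrow> q S = q {} + c *\<^sub>R char_vec S"
proof -
  have face: "f (q S) = f (q T)"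
    if "linear f" "stable_set E S" "stable_set E T"
      "\<And>U. stable_set E U \<Longrightarrow> m \<le> f (char_vec U)" "f (char_vec S) = m" "f (char_vec T) = m"
    for f :: "real ^ 'v \<Rightarrow> real" and m S T
  proof (rule summand_const_on_face[OF that(1)])
    show "m \<le> f y" if "y \<in> Q + R" for y
      using linear_le_on_Stab[OF \<open>linear f\<close>] \<open>\<And>U. stable_set E U \<Longrightarrow> m \<le> f (char_vec U)\<close>
        that sum by blast
    show "f (q S + (char_vec S - q S)) = m" "f (q T + (char_vec T - q T)) = m"
      using that(5,6) by simp_all
  qed (use that(2,3) q r in simp_all)
  have sg: "stable_set E {v}" for v
    using assms(1) by (rule stable_set_singleton)
  have lin: "linear (\<lambda>x :: real ^ 'v. x $ w)" "linear (\<lambda>x :: real ^ 'v. - x $ w)"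
    "linear (\<lambda>x :: real ^ 'v. - x $ u - x $ w)" for u w
    by (auto intro!: linearI simp: algebra_simps)
  have out: "q S $ w = q {} $ w" if "stable_set E S" "w \<notin> S" for S w
    by (rule face[OF lin(1), where m = 0]) (use that in auto)
  have inn: "q S $ w = q {w} $ w" if "stable_set E S" "w \<in> S" for S w
    using face[OF lin(2) that(1) sg, of "- 1" w w] that by simp
  define d where "d w = q {w} $ w - q {} $ w" for w
  have d_edge: "d u = d v" if "{u, v} \<in> E" for u v
  proof -
    have "u \<noteq> v"
      using that assms(1) by (auto simp: simple_graph_def)
    have "- 1 \<le> - char_vec U $ u - char_vec U $ v" if "stable_set E U" for U
      using that \<open>{u, v} \<in> E\<close> unfolding stable_set_def by auto
    then have "- q {u} $ u - q {u} $ v = - q {v} $ u - q {v} $ v"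
      using \<open>u \<noteq> v\<close> by (intro face[OF lin(3) sg sg, where m = "- 1"]) auto
    then show ?thesis
      using out[OF sg, of v u] out[OF sg, of u v] \<open>u \<noteq> v\<close> by (simp add: d_def)
  qed
  obtain c where c: "d w = c" for w
    using connected_imp_constant[OF assms(2), of d] d_edge by metis
  have "q S = q {} + c *\<^sub>R char_vec S" if "stable_set E S" for S
    using out[OF that] inn[OF that] c by (auto simp: vec_eq_iff d_def algebra_simps)
  then show ?thesis by blast
qed

lemma Stab_not_decomposable_if_connected:
  fixes E :: "'v::finite set set"
  assumes "simple_graph E" "graph_connected E"
  shows "\<not> decomposable (Stab E)"
proof
  assume "decomposable (Stab E)"
  then obtain Q R where QR: "polytope Q" "polytope R" and sum: "Stab E = Q + R"
    and nh: "\<not> homothetic Q (Stab E)" "\<not> homothetic R (Stab E)"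
    unfolding decomposable_def by blast
  have "\<exists>a. a \<in> Q \<and> char_vec S - a \<in> R" if "stable_set E S" for S
    using char_vec_in_Stab[OF that] unfolding sum by (auto elim!: set_plus_elim)
  then obtain q where q: "\<And>S. stable_set E S \<Longrightarrow> q S \<in> Q \<and> char_vec S - q S \<in> R"
    by metis
  obtain c where c: "\<And>S. stable_set E S \<Longrightarrow> q S = q {} + c *\<^sub>R char_vec S"
    using Stab_summand_dilation[OF assms sum, of q] q by metis
  have "homothetic Q (Stab E) \<or> homothetic R (Stab E)"
    unfolding Stab_def
  proof (rule homothetic_summand)
    show "convex hull {char_vec S |S. stable_set E S} = Q + R"
      using sum by (simp add: Stab_def)
    show "q {} + c *\<^sub>R x \<in> Q" "x - (q {} + c *\<^sub>R x) \<in> R"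
      if x: "x \<in> {char_vec S |S. stable_set E S}" for x
    proof -
      obtain S where S: "x = char_vec S" "stable_set E S" using x by blast
      show "q {} + c *\<^sub>R x \<in> Q" "x - (q {} + c *\<^sub>R x) \<in> R"
        using q[OF S(2)] unfolding S(1) c[OF S(2), symmetric] by simp_all
    qed
    show "{char_vec S |S. stable_set E S} \<noteq> {}"
      using stable_set_empty by blast
  qed (use QR in \<open>simp_all add: polytope_imp_convex\<close>)
  then show False using nh by blast
qed

lemma indecomposable_Stab_iff:
  "simple_graph E \<Longrightarrow> indecomposable (Stab E) \<longleftrightarrow> graph_connected E"
  using polytope_Stab decomposable_Stab_if_disconnected Stab_not_decomposable_if_connected
  unfolding indecomposable_def by blast

theorem theorem4p9:
  fixes E :: "'v::finite set set"
  assumes "simple_graph E"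
  shows "(indecomposable (Stab E) \<longleftrightarrow> graph_connected E) \<and>
         (indecomposable (Cli E) \<longleftrightarrow> graph_connected (complement_graph E))"
  unfolding Cli_def
  using indecomposable_Stab_iff[OF assms] indecomposable_Stab_iff[OF simple_graph_complement]
  by blast

end
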